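(* A functor $U : \mathcal{A}\to\mathcal{B}$ is stable if and only if it is a local right adjoint.
   Context: A functor $U : \mathcal{A} \rightarrow \mathcal{B}$ is a local right adjoint if for each object $A$ of $\mathcal{A}$ the functor on slices $\mathcal{A}/A \rightarrow \mathcal{B}/U(A)$, $(v: A'\to A)\mapsto (U(v): U(A')\to U(A))$, has a left adjoint. A candidate for $U$ is a morphism $n : B\to U(A)$ in $\mathcal{B}$ (with $A$ in $\mathcal{A}$) such that for all $f : B\to U(A_1)$ in $\mathcal{B}$ and $u : A\to A_2$, $v : A_1\to A_2$ in $\mathcal{A}$ with $U(v)f = U(u)n$, there exists a unique $w : A\to A_1$ in $\mathcal{A}$ such that $U(w)n = f$ and $vw = u$. $U$ is stable if every morphism $f : B\to U(A)$ in $\mathcal{B}$ factorizes, uniquely (up to unique isomorphism), as $f = U(u_f)n_f$ with $n_f : B\to U(A_f)$ a candidate and $u_f : A_f\to A$ in $\mathcal{A}$. *)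

theory Defs
  imports Main
begin

section \<open>Categories and functors\<close>

record ('o, 'm) cat =
  Obj :: "'o set"
  Arr :: "'m set"
  Dom :: "'m \<Rightarrow> 'o"
  Cod :: "'m \<Rightarrow> 'o"
  Id :: "'o \<Rightarrow> 'm"
  Comp :: "'m \<Rightarrow> 'm \<Rightarrow> 'm" (infixl "\<cdot>\<index>" 70)

definition hom :: "('o, 'm) cat \<Rightarrow> 'o \<Rightarrow> 'o \<Rightarrow> 'm set" where
  "hom C a b = {f \<in> Arr C. Dom C f = a \<and> Cod C f = b}"

text \<open>Composition is written in the usual order: \<open>g \<cdot> f\<close> is \<open>g\<close> after \<open>f\<close>.\<close>

locale category =
  fixes C :: "('o, 'm) cat" (structure)
  assumes dom_Obj: "f \<in> Arr C \<Longrightarrow> Dom C f \<in> Obj C"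
    and cod_Obj: "f \<in> Arr C \<Longrightarrow> Cod C f \<in> Obj C"
    and id_hom: "a \<in> Obj C \<Longrightarrow> Id C a \<in> hom C a a"
    and comp_hom: "\<lbrakk>f \<in> hom C a b; g \<in> hom C b c\<rbrakk> \<Longrightarrow> g \<cdot> f \<in> hom C a c"
    and id_right: "f \<in> hom C a b \<Longrightarrow> f \<cdot> Id C a = f"
    and id_left: "f \<in> hom C a b \<Longrightarrow> Id C b \<cdot> f = f"
    and assoc: "\<lbrakk>f \<in> hom C a b; g \<in> hom C b c; h \<in> hom C c d\<rbrakk>
                  \<Longrightarrow> (h \<cdot> g) \<cdot> f = h \<cdot> (g \<cdot> f)"

record ('o1, 'm1, 'o2, 'm2) ftor =
  omap :: "'o1 \<Rightarrow> 'o2"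
  amap :: "'m1 \<Rightarrow> 'm2"

locale cat_functor = source: category C + target: category D
  for C :: "('o1, 'm1) cat" and D :: "('o2, 'm2) cat"
    and F :: "('o1, 'm1, 'o2, 'm2) ftor" +
  assumes omap_Obj: "a \<in> Obj C \<Longrightarrow> omap F a \<in> Obj D"
    and amap_hom: "f \<in> hom C a b \<Longrightarrow> amap F f \<in> hom D (omap F a) (omap F b)"
    and amap_Id: "a \<in> Obj C \<Longrightarrow> amap F (Id C a) = Id D (omap F a)"
    and amap_Comp: "\<lbrakk>f \<in> hom C a b; g \<in> hom C b c\<rbrakk>
                      \<Longrightarrow> amap F (g \<cdot>\<^bsub>C\<^esub> f) = amap F g \<cdot>\<^bsub>D\<^esub> amap F f"

definition isos :: "('o, 'm) cat \<Rightarrow> 'o \<Rightarrow> 'o \<Rightarrow> 'm set" where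
  "isos C a b = {f \<in> hom C a b. \<exists>g \<in> hom C b a. g \<cdot>\<^bsub>C\<^esub> f = Id C a \<and> f \<cdot>\<^bsub>C\<^esub> g = Id C b}"

section \<open>Adjunctions\<close>

text \<open>\<open>F : D \<rightarrow> C\<close> is left adjoint to \<open>G : C \<rightarrow> D\<close> via bijections
  \<open>\<phi> y x : C(F y, x) \<cong> D(y, G x)\<close>, natural in both variables.\<close>

locale adjunction = left: cat_functor D C F + right: cat_functor C D G
  for C :: "('o1, 'm1) cat" and D :: "('o2, 'm2) cat"
    and F :: "('o2, 'm2, 'o1, 'm1) ftor" and G :: "('o1, 'm1, 'o2, 'm2) ftor"
    and \<phi> :: "'o2 \<Rightarrow> 'o1 \<Rightarrow> 'm1 \<Rightarrow> 'm2" +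
  assumes bij: "\<lbrakk>y \<in> Obj D; x \<in> Obj C\<rbrakk>
      \<Longrightarrow> bij_betw (\<phi> y x) (hom C (omap F y) x) (hom D y (omap G x))"
    and natural: "\<lbrakk>g \<in> hom D y' y; h \<in> hom C (omap F y) x; f \<in> hom C x x'\<rbrakk>
      \<Longrightarrow> \<phi> y' x' (f \<cdot>\<^bsub>C\<^esub> h \<cdot>\<^bsub>C\<^esub> amap F g) = amap G f \<cdot>\<^bsub>D\<^esub> \<phi> y x h \<cdot>\<^bsub>D\<^esub> g"

definition has_left_adjoint ::
  "('o1, 'm1) cat \<Rightarrow> ('o2, 'm2) cat \<Rightarrow> ('o1, 'm1, 'o2, 'm2) ftor \<Rightarrow> bool" where
  "has_left_adjoint C D G \<longleftrightarrow> (\<exists>F \<phi>. adjunction C D F G \<phi>)"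

section \<open>Slices and local right adjoints\<close>

text \<open>An arrow from \<open>f\<close> to \<open>g\<close> in the slice over \<open>a\<close> is an arrow \<open>h\<close> of \<open>C\<close> with
  \<open>g \<cdot> h = f\<close>. It is stored as the triple \<open>(f, h, g)\<close>, because \<open>h\<close> alone does not
  determine its domain and codomain in the slice.\<close>

definition slice :: "('o, 'm) cat \<Rightarrow> 'o \<Rightarrow> ('m, 'm \<times> 'm \<times> 'm) cat" where
  "slice C a = \<lparr>
     Obj = {f \<in> Arr C. Cod C f = a},
     Arr = {(f, h, g). f \<in> Arr C \<and> Cod C f = a \<and> g \<in> Arr C \<and> Cod C g = a \<and>
                       h \<in> hom C (Dom C f) (Dom C g) \<and> g \<cdot>\<^bsub>C\<^esub> h = f},
     Dom = (\<lambda>(f, h, g). f),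
     Cod = (\<lambda>(f, h, g). g),
     Id = (\<lambda>f. (f, Id C (Dom C f), f)),
     Comp = (\<lambda>(g', k, l) (f, h, g). (f, k \<cdot>\<^bsub>C\<^esub> h, l)) \<rparr>"

definition slice_functor ::
  "('o1, 'm1, 'o2, 'm2) ftor \<Rightarrow> ('m1, 'm1 \<times> 'm1 \<times> 'm1, 'm2, 'm2 \<times> 'm2 \<times> 'm2) ftor" where
  "slice_functor U = \<lparr>
     omap = amap U,
     amap = (\<lambda>(f, h, g). (amap U f, amap U h, amap U g)) \<rparr>"

definition local_right_adjoint ::
  "('o1, 'm1) cat \<Rightarrow> ('o2, 'm2) cat \<Rightarrow> ('o1, 'm1, 'o2, 'm2) ftor \<Rightarrow> bool" where
  "local_right_adjoint A B U \<longleftrightarrow>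
     (\<forall>a \<in> Obj A. has_left_adjoint (slice A a) (slice B (omap U a)) (slice_functor U))"

lemma slice_hom:
  "t \<in> hom (slice C a) f g \<longleftrightarrow>
     (\<exists>h. t = (f, h, g) \<and> f \<in> Arr C \<and> Cod C f = a \<and> g \<in> Arr C \<and> Cod C g = a \<and>
          h \<in> hom C (Dom C f) (Dom C g) \<and> g \<cdot>\<^bsub>C\<^esub> h = f)"
  by (cases t) (auto simp: slice_def hom_def)

lemma arr_hom: "f \<in> Arr C \<Longrightarrow> Cod C f = a \<Longrightarrow> f \<in> hom C (Dom C f) a"
  by (simp add: hom_def)

lemma category_slice:
  assumes "category C" shows "category (slice C a)"
proof -
  interpret category C by fact
  show ?thesis
  proof
    show "Dom (slice C a) t \<in> Obj (slice C a)" if "t \<in> Arr (slice C a)" for t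
      using that by (auto simp: slice_def)
    show "Cod (slice C a) t \<in> Obj (slice C a)" if "t \<in> Arr (slice C a)" for t
      using that by (auto simp: slice_def)
    show "Id (slice C a) f \<in> hom (slice C a) f f" if "f \<in> Obj (slice C a)" for f
    proof -
      have f: "f \<in> Arr C" "Cod C f = a" using that by (auto simp: slice_def)
      show ?thesis
        unfolding slice_hom using f id_hom[OF dom_Obj[OF f(1)]] id_right[OF arr_hom[OF f]]
        by (simp add: slice_def)
    qed
    show "t \<cdot>\<^bsub>slice C a\<^esub> s \<in> hom (slice C a) f h"
      if st: "s \<in> hom (slice C a) f g" "t \<in> hom (slice C a) g h" for s t f g h
    proof -
      obtain k l where k: "s = (f, k, g)" "f \<in> Arr C" "Cod C f = a"
          "k \<in> hom C (Dom C f) (Dom C g)" "g \<cdot>\<^bsub>C\<^esub> k = f"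
        and l: "t = (g, l, h)" "h \<in> Arr C" "Cod C h = a"
          "l \<in> hom C (Dom C g) (Dom C h)" "h \<cdot>\<^bsub>C\<^esub> l = g"
        using st unfolding slice_hom by blast
      have "h \<cdot>\<^bsub>C\<^esub> (l \<cdot>\<^bsub>C\<^esub> k) = f"
        using assoc[OF k(4) l(4) arr_hom[OF l(2,3)]] k(5) l(5) by simp
      then show ?thesis
        unfolding slice_hom using k l comp_hom[OF k(4) l(4)] by (simp add: slice_def)
    qed
    show "s \<cdot>\<^bsub>slice C a\<^esub> Id (slice C a) f = s" if st: "s \<in> hom (slice C a) f g" for s f g
    proof -
      obtain k where k: "s = (f, k, g)" "k \<in> hom C (Dom C f) (Dom C g)"
        using st unfolding slice_hom by blast
      show ?thesis using k(1) id_right[OF k(2)] by (simp add: slice_def)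
    qed
    show "Id (slice C a) g \<cdot>\<^bsub>slice C a\<^esub> s = s" if st: "s \<in> hom (slice C a) f g" for s f g
    proof -
      obtain k where k: "s = (f, k, g)" "k \<in> hom C (Dom C f) (Dom C g)"
        using st unfolding slice_hom by blast
      show ?thesis using k(1) id_left[OF k(2)] by (simp add: slice_def)
    qed
    show "r \<cdot>\<^bsub>slice C a\<^esub> t \<cdot>\<^bsub>slice C a\<^esub> s = r \<cdot>\<^bsub>slice C a\<^esub> (t \<cdot>\<^bsub>slice C a\<^esub> s)"
      if st: "s \<in> hom (slice C a) f g" "t \<in> hom (slice C a) g h" "r \<in> hom (slice C a) h i"
      for s t r f g h i
    proof -
      obtain k l m where k: "s = (f, k, g)" "k \<in> hom C (Dom C f) (Dom C g)"
        and l: "t = (g, l, h)" "l \<in> hom C (Dom C g) (Dom C h)"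
        and m: "r = (h, m, i)" "m \<in> hom C (Dom C h) (Dom C i)"
        using st unfolding slice_hom by blast
      show ?thesis using k(1) l(1) m(1) assoc[OF k(2) l(2) m(2)] by (simp add: slice_def)
    qed
  qed
qed

lemma cat_functor_slice:
  assumes "cat_functor A B U"
  shows "cat_functor (slice A a) (slice B (omap U a)) (slice_functor U)"
proof -
  interpret cat_functor A B U by fact
  interpret S: category "slice A a" by (rule category_slice) unfold_locales
  interpret T: category "slice B (omap U a)" by (rule category_slice) unfold_locales
  have arr: "amap U f \<in> Arr B" "Dom B (amap U f) = omap U (Dom A f)"
    "Cod B (amap U f) = omap U (Cod A f)" if "f \<in> Arr A" for f
    using amap_hom[of f "Dom A f" "Cod A f"] that by (auto simp: hom_def)
  show ?thesis
  proof
    show "omap (slice_functor U) f \<in> Obj (slice B (omap U a))" if "f \<in> Obj (slice A a)" for f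
      using that arr by (auto simp: slice_def slice_functor_def)
    show "amap (slice_functor U) s
        \<in> hom (slice B (omap U a)) (omap (slice_functor U) f) (omap (slice_functor U) g)"
      if st: "s \<in> hom (slice A a) f g" for s f g
    proof -
      obtain k where k: "s = (f, k, g)" "f \<in> Arr A" "Cod A f = a" "g \<in> Arr A" "Cod A g = a"
          "k \<in> hom A (Dom A f) (Dom A g)" "g \<cdot>\<^bsub>A\<^esub> k = f"
        using st unfolding slice_hom by blast
      show ?thesis
        unfolding slice_hom
        using k(1,3,5) arr[OF k(2)] arr[OF k(4)] amap_hom[OF k(6)]
          amap_Comp[OF k(6) arr_hom[OF k(4,5)], unfolded k(7), symmetric]
        by (simp add: slice_functor_def)
    qed
    show "amap (slice_functor U) (Id (slice A a) f)
        = Id (slice B (omap U a)) (omap (slice_functor U) f)" if "f \<in> Obj (slice A a)" for f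
      using that arr amap_Id[OF source.dom_Obj] by (simp add: slice_def slice_functor_def)
    show "amap (slice_functor U) (t \<cdot>\<^bsub>slice A a\<^esub> s)
        = amap (slice_functor U) t \<cdot>\<^bsub>slice B (omap U a)\<^esub> amap (slice_functor U) s"
      if st: "s \<in> hom (slice A a) f g" "t \<in> hom (slice A a) g h" for s t f g h
    proof -
      obtain k l where k: "s = (f, k, g)" "k \<in> hom A (Dom A f) (Dom A g)"
        and l: "t = (g, l, h)" "l \<in> hom A (Dom A g) (Dom A h)"
        using st unfolding slice_hom by blast
      show ?thesis
        using k(1) l(1) amap_Comp[OF k(2) l(2)] by (simp add: slice_def slice_functor_def)
    qed
  qed
qed

section \<open>Candidates and stable functors\<close>

text \<open>The object \<open>a\<close> is part of the data of a candidate \<open>n : b \<rightarrow> U a\<close>: it need not be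
  determined by the codomain of \<open>n\<close>.\<close>

definition candidate ::
  "('o1, 'm1) cat \<Rightarrow> ('o2, 'm2) cat \<Rightarrow> ('o1, 'm1, 'o2, 'm2) ftor \<Rightarrow> 'o2 \<Rightarrow> 'o1 \<Rightarrow> 'm2 \<Rightarrow> bool"
where
  "candidate A B U b a n \<longleftrightarrow>
     b \<in> Obj B \<and> a \<in> Obj A \<and> n \<in> hom B b (omap U a) \<and>
     (\<forall>a1 \<in> Obj A. \<forall>a2 \<in> Obj A.
       \<forall>f \<in> hom B b (omap U a1). \<forall>u \<in> hom A a a2. \<forall>v \<in> hom A a1 a2.
         amap U v \<cdot>\<^bsub>B\<^esub> f = amap U u \<cdot>\<^bsub>B\<^esub> n \<longrightarrow>
         (\<exists>!w. w \<in> hom A a a1 \<and> amap U w \<cdot>\<^bsub>B\<^esub> n = f \<and> v \<cdot>\<^bsub>A\<^esub> w = u))"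

definition candidate_factorization ::
  "('o1, 'm1) cat \<Rightarrow> ('o2, 'm2) cat \<Rightarrow> ('o1, 'm1, 'o2, 'm2) ftor \<Rightarrow>
   'o2 \<Rightarrow> 'o1 \<Rightarrow> 'm2 \<Rightarrow> 'o1 \<Rightarrow> 'm2 \<Rightarrow> 'm1 \<Rightarrow> bool"
where
  "candidate_factorization A B U b a f c n u \<longleftrightarrow>
     candidate A B U b c n \<and> u \<in> hom A c a \<and> f = amap U u \<cdot>\<^bsub>B\<^esub> n"

definition stable ::
  "('o1, 'm1) cat \<Rightarrow> ('o2, 'm2) cat \<Rightarrow> ('o1, 'm1, 'o2, 'm2) ftor \<Rightarrow> bool" where
  "stable A B U \<longleftrightarrow>
     (\<forall>b \<in> Obj B. \<forall>a \<in> Obj A. \<forall>f \<in> hom B b (omap U a).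
        (\<exists>c n u. candidate_factorization A B U b a f c n u) \<and>
        (\<forall>c n u c' n' u'.
           candidate_factorization A B U b a f c n u \<longrightarrow>
           candidate_factorization A B U b a f c' n' u' \<longrightarrow>
           (\<exists>!w. w \<in> isos A c c' \<and> amap U w \<cdot>\<^bsub>B\<^esub> n = n' \<and> u' \<cdot>\<^bsub>A\<^esub> w = u)))"

end

theory Submission imports Defs begin

text \<open>A functor has a left adjoint iff every object admits a universal arrow into it. A universal
  arrow from \<open>f : b \<rightarrow> U a\<close> to the slice functor over \<open>a\<close> is a factorization \<open>f = U u \<cdot> n\<close> that is
  initial among the factorizations of \<open>f\<close> through an arrow into \<open>a\<close>. If \<open>n\<close> is a candidate this
  initiality is the defining property of \<open>n\<close> restricted to \<open>a2 = a\<close>. Conversely, let \<open>(n, u)\<close> be initial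
  over \<open>a\<close> and let \<open>u' : c \<rightarrow> a2\<close>. The initial factorization \<open>(n', u'')\<close> of \<open>U u' \<cdot> n\<close> over \<open>a2\<close> maps to
  \<open>(n, u')\<close>, and initiality of \<open>(n, u)\<close> provides an inverse of this map. Thus \<open>(n, u')\<close> is initial
  over \<open>a2\<close> as well, for all \<open>u'\<close>, so \<open>n\<close> is a candidate.\<close>

section \<open>Universal arrows and adjunctions\<close>

definition universal_arrow ::
  "('o1, 'm1) cat \<Rightarrow> ('o2, 'm2) cat \<Rightarrow> ('o1, 'm1, 'o2, 'm2) ftor \<Rightarrow> 'o2 \<Rightarrow> 'o1 \<Rightarrow> 'm2 \<Rightarrow> bool"
where
  "universal_arrow C D G y x e \<longleftrightarrow>
     x \<in> Obj C \<and> e \<in> hom D y (omap G x) \<and>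
     (\<forall>x' \<in> Obj C. \<forall>g \<in> hom D y (omap G x').
        \<exists>!h. h \<in> hom C x x' \<and> amap G h \<cdot>\<^bsub>D\<^esub> e = g)"

lemma (in category) hom_Obj:
  assumes "f \<in> hom C a b"
  shows "a \<in> Obj C" "b \<in> Obj C"
  using assms dom_Obj cod_Obj by (auto simp: hom_def)

text \<open>A Yoneda argument: the unit is the image of the identity under \<open>\<phi>\<close>,
  and naturality makes every \<open>\<phi> y x' h\<close> equal to \<open>G h\<close> after the
  unit. Bijectivity of \<open>\<phi>\<close> is then the universal property.\<close>

lemma (in adjunction) universal_arrow_unit:
  assumes y: "y \<in> Obj D"
  shows "universal_arrow C D G y (omap F y) (\<phi> y (omap F y) (Id C (omap F y)))"
    (is "universal_arrow C D G y ?x ?e")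
proof -
  have x: "?x \<in> Obj C" using y by (rule left.omap_Obj)
  have e: "?e \<in> hom D y (omap G ?x)"
    using bij[OF y x] left.target.id_hom[OF x] by (auto simp: bij_betw_def)
  have phi: "\<phi> y x' h = amap G h \<cdot>\<^bsub>D\<^esub> ?e" if h: "h \<in> hom C ?x x'" for x' h
  proof -
    \<comment> \<open>Naturality is applied to the identity of \<open>?x\<close>, precomposed with
      the identity of \<open>y\<close> and postcomposed with \<open>h\<close> itself.\<close>
    have "\<phi> y x' (h \<cdot>\<^bsub>C\<^esub> Id C ?x \<cdot>\<^bsub>C\<^esub> amap F (Id D y)) = amap G h \<cdot>\<^bsub>D\<^esub> ?e \<cdot>\<^bsub>D\<^esub> Id D y"
      by (rule natural[OF left.source.id_hom[OF y] left.target.id_hom[OF x] h])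
    moreover have "amap G h \<cdot>\<^bsub>D\<^esub> ?e \<in> hom D y (omap G x')"
      using left.source.comp_hom[OF e right.amap_hom[OF h]] .
    ultimately show ?thesis
      using h left.amap_Id[OF y] left.target.id_right[OF h] left.source.id_right by simp
  qed
  have "\<exists>!h. h \<in> hom C ?x x' \<and> amap G h \<cdot>\<^bsub>D\<^esub> ?e = g"
    if x': "x' \<in> Obj C" and g: "g \<in> hom D y (omap G x')" for x' g
  proof -
    note b = bij[OF y x']
    have "g \<in> \<phi> y x' ` hom C ?x x'" using g bij_betw_imp_surj_on[OF b] by simp
    then obtain h where h: "h \<in> hom C ?x x'" "g = \<phi> y x' h" by (rule imageE)
    show ?thesis
    proof (intro ex1I[of _ h] conjI)
      show "h \<in> hom C ?x x'" by (rule h)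
      show "amap G h \<cdot>\<^bsub>D\<^esub> ?e = g" using phi[OF h(1)] h(2) by simp
      show "k = h" if "k \<in> hom C ?x x' \<and> amap G k \<cdot>\<^bsub>D\<^esub> ?e = g" for k
        using inj_onD[OF bij_betw_imp_inj_on[OF b]] h phi[of k] that by metis
    qed
  qed
  then show ?thesis unfolding universal_arrow_def using x e by (intro conjI ballI)
qed

text \<open>Choose a universal arrow \<open>e y : y \<rightarrow> F (X y)\<close> for each
  \<open>y\<close>. The left adjoint \<open>L\<close> has object map \<open>X\<close>, its action on
  arrows is forced by naturality of \<open>e\<close>, and uniqueness yields functoriality.\<close>

lemma (in cat_functor) has_left_adjoint_if_universal_arrows:
  assumes ex: "\<And>y. y \<in> Obj D \<Longrightarrow> \<exists>x e. universal_arrow C D F y x e"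
  shows "has_left_adjoint C D F"
proof -
  obtain X e where univ: "universal_arrow C D F y (X y) (e y)" if "y \<in> Obj D" for y
    using ex by metis
  have X: "X y \<in> Obj C" and e: "e y \<in> hom D y (omap F (X y))" if "y \<in> Obj D" for y
    using univ[OF that] by (auto simp: universal_arrow_def)
  have ex1: "\<exists>!h. h \<in> hom C (X y) x \<and> amap F h \<cdot>\<^bsub>D\<^esub> e y = g"
    if "y \<in> Obj D" "x \<in> Obj C" "g \<in> hom D y (omap F x)" for y x g
    using univ[OF that(1)] that(2,3) by (auto simp: universal_arrow_def)
  \<comment> \<open>For \<open>g : y \<rightarrow> z\<close> the value is the unique
    \<open>h\<close> that closes the naturality square of \<open>e\<close> at \<open>g\<close>;
    \<open>y\<close> and \<open>z\<close> are read off from \<open>g\<close>.\<close>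
  define L where "L = \<lparr>omap = X, amap = \<lambda>g. THE h.
    h \<in> hom C (X (Dom D g)) (X (Cod D g)) \<and> amap F h \<cdot>\<^bsub>D\<^esub> e (Dom D g) = e (Cod D g) \<cdot>\<^bsub>D\<^esub> g\<rparr>"
  have L: "amap L g \<in> hom C (X y) (X z) \<and> amap F (amap L g) \<cdot>\<^bsub>D\<^esub> e y = e z \<cdot>\<^bsub>D\<^esub> g"
    if g: "g \<in> hom D y z" for g y z
  proof -
    note yz = target.hom_Obj[OF g]
    have "Dom D g = y" "Cod D g = z" using g by (auto simp: hom_def)
    then show ?thesis
      using theI'[OF ex1[OF yz(1) X[OF yz(2)] target.comp_hom[OF g e[OF yz(2)]]]]
      by (simp add: L_def)
  qed
  \<comment> \<open>Both functor laws come from this: it suffices that the expected value closes the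
    naturality square.\<close>
  have L_eq: "amap L g = h"
    if g: "g \<in> hom D y z" and h: "h \<in> hom C (X y) (X z)" "amap F h \<cdot>\<^bsub>D\<^esub> e y = e z \<cdot>\<^bsub>D\<^esub> g" for g h y z
  proof -
    note yz = target.hom_Obj[OF g]
    show ?thesis
      using ex1[OF yz(1) X[OF yz(2)] target.comp_hom[OF g e[OF yz(2)]]] L[OF g] h by blast
  qed
  interpret L: cat_functor D C L
  proof
    show "omap L y \<in> Obj C" if "y \<in> Obj D" for y using X[OF that] by (simp add: L_def)
    show "amap L g \<in> hom C (omap L y) (omap L z)" if "g \<in> hom D y z" for g y z
      using L[OF that] by (simp add: L_def)
    show "amap L (Id D y) = Id C (omap L y)" if y: "y \<in> Obj D" for y
    proof -
      have "amap L (Id D y) = Id C (X y)"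
        by (rule L_eq[OF target.id_hom[OF y] source.id_hom[OF X[OF y]]])
          (simp add: amap_Id[OF X[OF y]] target.id_left[OF e[OF y]] target.id_right[OF e[OF y]])
      then show ?thesis by (simp add: L_def)
    qed
    show "amap L (h \<cdot>\<^bsub>D\<^esub> g) = amap L h \<cdot>\<^bsub>C\<^esub> amap L g"
      if g: "g \<in> hom D y z" and h: "h \<in> hom D z w" for g h y z w
    proof (rule L_eq[OF target.comp_hom[OF g h]])
      note y = target.hom_Obj(1)[OF g] and z = target.hom_Obj(2)[OF g]
        and w = target.hom_Obj(2)[OF h]
      note Lg = L[OF g, THEN conjunct1] and Lh = L[OF h, THEN conjunct1]
      show "amap L h \<cdot>\<^bsub>C\<^esub> amap L g \<in> hom C (X y) (X w)" using source.comp_hom[OF Lg Lh] .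
      \<comment> \<open>Paste the naturality squares of \<open>g\<close> and
        \<open>h\<close>.\<close>
      have "amap F (amap L h \<cdot>\<^bsub>C\<^esub> amap L g) \<cdot>\<^bsub>D\<^esub> e y
          = amap F (amap L h) \<cdot>\<^bsub>D\<^esub> (amap F (amap L g) \<cdot>\<^bsub>D\<^esub> e y)"
        using amap_Comp[OF Lg Lh] target.assoc[OF e[OF y] amap_hom[OF Lg] amap_hom[OF Lh]] by simp
      also have "\<dots> = amap F (amap L h) \<cdot>\<^bsub>D\<^esub> e z \<cdot>\<^bsub>D\<^esub> g"
        using L[OF g] target.assoc[OF g e[OF z] amap_hom[OF Lh]] by simp
      also have "\<dots> = e w \<cdot>\<^bsub>D\<^esub> (h \<cdot>\<^bsub>D\<^esub> g)"
        using L[OF h] target.assoc[OF g h e[OF w]] by simp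
      finally show "amap F (amap L h \<cdot>\<^bsub>C\<^esub> amap L g) \<cdot>\<^bsub>D\<^esub> e y = e w \<cdot>\<^bsub>D\<^esub> (h \<cdot>\<^bsub>D\<^esub> g)" .
    qed
  qed
  \<comment> \<open>Transposition is composition with \<open>e y\<close>. Its bijectivity is
    universality, and its naturality in \<open>y\<close> is the square that defines \<open>L\<close>
    on arrows.\<close>
  have "adjunction C D L F (\<lambda>y x h. amap F h \<cdot>\<^bsub>D\<^esub> e y)"
  proof
    show "bij_betw (\<lambda>h. amap F h \<cdot>\<^bsub>D\<^esub> e y) (hom C (omap L y) x) (hom D y (omap F x))"
      if y: "y \<in> Obj D" and x: "x \<in> Obj C" for y x
    proof -
      have into: "amap F h \<cdot>\<^bsub>D\<^esub> e y \<in> hom D y (omap F x)" if "h \<in> hom C (X y) x" for h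
        using target.comp_hom[OF e[OF y] amap_hom[OF that]] .
      have "inj_on (\<lambda>h. amap F h \<cdot>\<^bsub>D\<^esub> e y) (hom C (X y) x)"
        using ex1[OF y x] into unfolding inj_on_def by metis
      moreover have "(\<lambda>h. amap F h \<cdot>\<^bsub>D\<^esub> e y) ` hom C (X y) x = hom D y (omap F x)"
        using ex1[OF y x] into by blast
      ultimately show ?thesis by (simp add: bij_betw_def L_def)
    qed
    show "amap F (f \<cdot>\<^bsub>C\<^esub> h \<cdot>\<^bsub>C\<^esub> amap L g) \<cdot>\<^bsub>D\<^esub> e y'
        = amap F f \<cdot>\<^bsub>D\<^esub> (amap F h \<cdot>\<^bsub>D\<^esub> e y) \<cdot>\<^bsub>D\<^esub> g"
      if g: "g \<in> hom D y' y" and h: "h \<in> hom C (omap L y) x" and f: "f \<in> hom C x x'"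
      for g y y' h x x' f
    proof -
      note y' = target.hom_Obj(1)[OF g] and y = target.hom_Obj(2)[OF g]
      have h': "h \<in> hom C (X y) x" using h by (simp add: L_def)
      note Lg = L[OF g, THEN conjunct1] and fh = source.comp_hom[OF h' f]
      have "amap F (f \<cdot>\<^bsub>C\<^esub> h \<cdot>\<^bsub>C\<^esub> amap L g) \<cdot>\<^bsub>D\<^esub> e y'
          = amap F (f \<cdot>\<^bsub>C\<^esub> h) \<cdot>\<^bsub>D\<^esub> (amap F (amap L g) \<cdot>\<^bsub>D\<^esub> e y')"
        using amap_Comp[OF Lg fh] target.assoc[OF e[OF y'] amap_hom[OF Lg] amap_hom[OF fh]] by simp
      also have "\<dots> = amap F (f \<cdot>\<^bsub>C\<^esub> h) \<cdot>\<^bsub>D\<^esub> e y \<cdot>\<^bsub>D\<^esub> g"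
        using L[OF g] target.assoc[OF g e[OF y] amap_hom[OF fh]] by simp
      also have "amap F (f \<cdot>\<^bsub>C\<^esub> h) \<cdot>\<^bsub>D\<^esub> e y = amap F f \<cdot>\<^bsub>D\<^esub> (amap F h \<cdot>\<^bsub>D\<^esub> e y)"
        using amap_Comp[OF h' f] target.assoc[OF e[OF y] amap_hom[OF h'] amap_hom[OF f]] by simp
      finally show ?thesis .
    qed
  qed
  then show ?thesis unfolding has_left_adjoint_def by blast
qed

lemma (in cat_functor) has_left_adjoint_iff_universal_arrows:
  "has_left_adjoint C D F \<longleftrightarrow> (\<forall>y \<in> Obj D. \<exists>x e. universal_arrow C D F y x e)"
proof
  assume "has_left_adjoint C D F"
  then obtain L \<phi> where "adjunction C D L F \<phi>" unfolding has_left_adjoint_def by blast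
  then show "\<forall>y \<in> Obj D. \<exists>x e. universal_arrow C D F y x e"
    by (intro ballI exI) (rule adjunction.universal_arrow_unit)
qed (use has_left_adjoint_if_universal_arrows in blast)

section \<open>Initial factorizations\<close>

text \<open>An initial object among the factorizations of \<open>f\<close> through arrows into the
  fixed object \<open>a\<close>. In \<open>candidate\<close>, by contrast, the arrow out of
  \<open>c\<close> and its codomain vary.\<close>

definition initial_factorization ::
  "('o1, 'm1) cat \<Rightarrow> ('o2, 'm2) cat \<Rightarrow> ('o1, 'm1, 'o2, 'm2) ftor \<Rightarrow>
   'o2 \<Rightarrow> 'o1 \<Rightarrow> 'm2 \<Rightarrow> 'o1 \<Rightarrow> 'm2 \<Rightarrow> 'm1 \<Rightarrow> bool"
where
  "initial_factorization A B U b a f c n u \<longleftrightarrow>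
     n \<in> hom B b (omap U c) \<and> u \<in> hom A c a \<and> amap U u \<cdot>\<^bsub>B\<^esub> n = f \<and>
     (\<forall>c' g v. g \<in> hom B b (omap U c') \<longrightarrow> v \<in> hom A c' a \<longrightarrow> amap U v \<cdot>\<^bsub>B\<^esub> g = f \<longrightarrow>
        (\<exists>!w. w \<in> hom A c c' \<and> amap U w \<cdot>\<^bsub>B\<^esub> n = g \<and> v \<cdot>\<^bsub>A\<^esub> w = u))"

lemma slice_Obj: "f \<in> Obj (slice C a) \<longleftrightarrow> f \<in> hom C (Dom C f) a"
  by (auto simp: slice_def hom_def)

lemma slice_hom':
  "t \<in> hom (slice C a) f g \<longleftrightarrow>
     (\<exists>h. t = (f, h, g) \<and> f \<in> hom C (Dom C f) a \<and> g \<in> hom C (Dom C g) a \<and>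
          h \<in> hom C (Dom C f) (Dom C g) \<and> g \<cdot>\<^bsub>C\<^esub> h = f)"
  unfolding slice_hom by (auto simp: hom_def)

lemma slice_Comp: "(g', k, l) \<cdot>\<^bsub>slice C a\<^esub> (f, h, g) = (f, k \<cdot>\<^bsub>C\<^esub> h, l)"
  by (simp add: slice_def)

text \<open>The outer entries of a slice triple are its endpoints, so only the middle entry is data.
  Thus \<open>e\<close> amounts to \<open>n\<close>, a slice arrow \<open>h\<close> amounts to
  \<open>w\<close>, and the slice object \<open>u\<close> carries \<open>c\<close> as its
  domain.\<close>

lemma (in cat_functor) universal_arrow_slice_iff:
  assumes f: "f \<in> hom D b (omap F a)"
  shows "universal_arrow (slice C a) (slice D (omap F a)) (slice_functor F) f u e \<longleftrightarrow>
    (\<exists>n. e = (f, n, amap F u) \<and> initial_factorization C D F b a f (Dom C u) n u)"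
    (is "?L \<longleftrightarrow> ?R")
proof -
  have Dom: "Dom D f = b" using f by (simp add: hom_def)
  have Uv: "Dom D (amap F v) = omap F (Dom C v)" "amap F v \<in> hom D (omap F (Dom C v)) (omap F a)"
    if "v \<in> hom C (Dom C v) a" for v
    using amap_hom[OF that] by (auto simp: hom_def)
  have Dom_eq: "Dom C v = c" if "v \<in> hom C c a" for v c using that by (simp add: hom_def)
  \<comment> \<open>Slice arrows from \<open>f\<close> to \<open>F v\<close> are the factorizations
    of \<open>f\<close> through \<open>F v\<close>.\<close>
  have e_iff: "e' \<in> hom (slice D (omap F a)) f (amap F v) \<longleftrightarrow>
      (\<exists>g. e' = (f, g, amap F v) \<and> g \<in> hom D b (omap F (Dom C v)) \<and> amap F v \<cdot>\<^bsub>D\<^esub> g = f)"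
    if "v \<in> hom C (Dom C v) a" for v e'
    unfolding slice_hom' using Uv[OF that] f Dom by simp
  have omap_slice: "omap (slice_functor F) v = amap F v" for v by (simp add: slice_functor_def)
  have h_iff: "(h \<in> hom (slice C a) u v \<and>
        amap (slice_functor F) h \<cdot>\<^bsub>slice D (omap F a)\<^esub> (f, n, amap F u) = (f, g, amap F v)) \<longleftrightarrow>
      (\<exists>w. h = (u, w, v) \<and> w \<in> hom C (Dom C u) (Dom C v) \<and> amap F w \<cdot>\<^bsub>D\<^esub> n = g \<and> v \<cdot>\<^bsub>C\<^esub> w = u)"
    if "u \<in> hom C (Dom C u) a" "v \<in> hom C (Dom C v) a" for h v n g
    using that unfolding slice_hom' by (auto simp: slice_Comp slice_functor_def)
  \<comment> \<open>Unique existence transfers along the injective map sending \<open>w\<close> to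
    \<open>(u, w, v)\<close>.\<close>
  have ex1_iff: "(\<exists>!h. \<exists>w. h = (u, w, v) \<and> P w) \<longleftrightarrow> (\<exists>!w. P w)" for v :: 'm1 and P :: "'m1 \<Rightarrow> bool"
    by blast
  have main: "universal_arrow (slice C a) (slice D (omap F a)) (slice_functor F) f u (f, n, amap F u)
      \<longleftrightarrow> initial_factorization C D F b a f (Dom C u) n u" (is "?L' \<longleftrightarrow> ?R'")
    if u: "u \<in> hom C (Dom C u) a" for n
  proof -
    let ?Q = "\<lambda>v g. \<exists>!w. w \<in> hom C (Dom C u) (Dom C v) \<and> amap F w \<cdot>\<^bsub>D\<^esub> n = g \<and> v \<cdot>\<^bsub>C\<^esub> w = u"
    have "(\<forall>e' \<in> hom (slice D (omap F a)) f (amap F v). \<exists>!h. h \<in> hom (slice C a) u v \<and>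
          amap (slice_functor F) h \<cdot>\<^bsub>slice D (omap F a)\<^esub> (f, n, amap F u) = e') \<longleftrightarrow>
        (\<forall>g. g \<in> hom D b (omap F (Dom C v)) \<longrightarrow> amap F v \<cdot>\<^bsub>D\<^esub> g = f \<longrightarrow> ?Q v g)"
      if v: "v \<in> hom C (Dom C v) a" for v
    proof -
      have "(\<exists>!h. h \<in> hom (slice C a) u v \<and>
          amap (slice_functor F) h \<cdot>\<^bsub>slice D (omap F a)\<^esub> (f, n, amap F u) = (f, g, amap F v)) \<longleftrightarrow> ?Q v g" for g
        unfolding h_iff[OF u v] by (rule ex1_iff)
      then show ?thesis unfolding Ball_def e_iff[OF v] by (simp add: imp_ex imp_conjL)
    qed
    then have "?L' \<longleftrightarrow> n \<in> hom D b (omap F (Dom C u)) \<and> amap F u \<cdot>\<^bsub>D\<^esub> n = f \<and>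
      (\<forall>v. v \<in> hom C (Dom C v) a \<longrightarrow>
        (\<forall>g. g \<in> hom D b (omap F (Dom C v)) \<longrightarrow> amap F v \<cdot>\<^bsub>D\<^esub> g = f \<longrightarrow> ?Q v g))"
      unfolding universal_arrow_def omap_slice using u by (simp add: e_iff[OF u] slice_Obj Ball_def)
    \<comment> \<open>Ranging over \<open>c'\<close> and \<open>v : c' \<rightarrow> a\<close> is
      the same as ranging over \<open>v\<close> alone, since \<open>c'\<close> must be
      \<open>Dom C v\<close>.\<close>
    also have "\<dots> \<longleftrightarrow> ?R'"
      unfolding initial_factorization_def using u Dom_eq by blast
    finally show ?thesis .
  qed
  show ?thesis
  proof
    assume L: ?L
    then have u: "u \<in> hom C (Dom C u) a" and "e \<in> hom (slice D (omap F a)) f (amap F u)"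
      by (auto simp: universal_arrow_def slice_Obj slice_functor_def)
    then obtain n where e: "e = (f, n, amap F u)" using e_iff[OF u] by blast
    with L have "initial_factorization C D F b a f (Dom C u) n u" using main[OF u] by simp
    with e show ?R by blast
  next
    assume ?R
    then obtain n where e: "e = (f, n, amap F u)"
      and init: "initial_factorization C D F b a f (Dom C u) n u" by blast
    have "u \<in> hom C (Dom C u) a" using init unfolding initial_factorization_def by blast
    then show ?L unfolding e using main init by simp
  qed
qed

text \<open>The objects of the slice over \<open>U a\<close> are the arrows
  \<open>f : b \<rightarrow> U a\<close> with arbitrary \<open>b\<close>, so the criterion by
  universal arrows asks for one initial factorization per such \<open>f\<close>.\<close>

lemma local_right_adjoint_iff_initial_factorizations:
  assumes "cat_functor A B U"
  shows "local_right_adjoint A B U \<longleftrightarrow>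
    (\<forall>a \<in> Obj A. \<forall>b. \<forall>f \<in> hom B b (omap U a). \<exists>c n u. initial_factorization A B U b a f c n u)"
proof -
  interpret cat_functor A B U by fact
  have "has_left_adjoint (slice A a) (slice B (omap U a)) (slice_functor U) \<longleftrightarrow>
      (\<forall>b. \<forall>f \<in> hom B b (omap U a). \<exists>c n u. initial_factorization A B U b a f c n u)" for a
  proof -
    interpret S: cat_functor "slice A a" "slice B (omap U a)" "slice_functor U"
      using assms by (rule cat_functor_slice)
    have "(\<exists>u e. universal_arrow (slice A a) (slice B (omap U a)) (slice_functor U) f u e) \<longleftrightarrow>
        (\<exists>c n u. initial_factorization A B U b a f c n u)" if "f \<in> hom B b (omap U a)" for f b
    proof -
      have "c = Dom A u" if "initial_factorization A B U b a f c n u" for c n u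
        using that by (auto simp: initial_factorization_def hom_def)
      then show ?thesis unfolding universal_arrow_slice_iff[OF that] by blast
    qed
    moreover have "f \<in> Obj (slice B (omap U a)) \<longleftrightarrow> (\<exists>b. f \<in> hom B b (omap U a))" for f
      by (auto simp: slice_def hom_def)
    ultimately show ?thesis
      unfolding S.has_left_adjoint_iff_universal_arrows Ball_def by metis
  qed
  then show ?thesis unfolding local_right_adjoint_def by blast
qed

section \<open>Candidates and initial factorizations\<close>

context cat_functor
begin

lemma amap_Comp_apply:
  assumes "n \<in> hom D b (omap F x)" "g \<in> hom C x y" "h \<in> hom C y z"
  shows "amap F (h \<cdot>\<^bsub>C\<^esub> g) \<cdot>\<^bsub>D\<^esub> n = amap F h \<cdot>\<^bsub>D\<^esub> (amap F g \<cdot>\<^bsub>D\<^esub> n)"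
  using amap_Comp[OF assms(2,3)] target.assoc[OF assms(1) amap_hom[OF assms(2)] amap_hom[OF assms(3)]]
  by simp

lemma amap_Id_apply:
  assumes "n \<in> hom D b (omap F x)" "x \<in> Obj C"
  shows "amap F (Id C x) \<cdot>\<^bsub>D\<^esub> n = n"
  using amap_Id[OF assms(2)] target.id_left[OF assms(1)] by simp

lemma candidate_imp_initial:
  assumes "candidate_factorization C D F b a f c n u"
  shows "initial_factorization C D F b a f c n u"
proof -
  have cand: "candidate C D F b c n" and u: "u \<in> hom C c a" and f: "f = amap F u \<cdot>\<^bsub>D\<^esub> n"
    using assms by (auto simp: candidate_factorization_def)
  have "\<exists>!w. w \<in> hom C c c' \<and> amap F w \<cdot>\<^bsub>D\<^esub> n = g \<and> v \<cdot>\<^bsub>C\<^esub> w = u"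
    if "g \<in> hom D b (omap F c')" "v \<in> hom C c' a" "amap F v \<cdot>\<^bsub>D\<^esub> g = f" for c' g v
    using cand source.hom_Obj[OF that(2)] that u unfolding candidate_def f by blast
  then show ?thesis
    using cand u f unfolding initial_factorization_def candidate_def by blast
qed

lemma initial_ex1:
  assumes "initial_factorization C D F b a f c n u"
    and "g \<in> hom D b (omap F c')" "v \<in> hom C c' a" "amap F v \<cdot>\<^bsub>D\<^esub> g = f"
  shows "\<exists>!w. w \<in> hom C c c' \<and> amap F w \<cdot>\<^bsub>D\<^esub> n = g \<and> v \<cdot>\<^bsub>C\<^esub> w = u"
  using assms unfolding initial_factorization_def by blast

text \<open>Both \<open>w\<close> and the identity map the factorization \<open>(n, u)\<close> to
  itself, so uniqueness equates them. This is how comparison arrows are shown to cancel.\<close>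

lemma initial_endo_eq_Id:
  assumes init: "initial_factorization C D F b a f c n u"
    and w: "w \<in> hom C c c" "amap F w \<cdot>\<^bsub>D\<^esub> n = n" "u \<cdot>\<^bsub>C\<^esub> w = u"
  shows "w = Id C c"
proof -
  have n: "n \<in> hom D b (omap F c)" and u: "u \<in> hom C c a" and f: "amap F u \<cdot>\<^bsub>D\<^esub> n = f"
    using init by (auto simp: initial_factorization_def)
  note c = source.hom_Obj(1)[OF u]
  show ?thesis
    using initial_ex1[OF init n u f] w source.id_hom[OF c] amap_Id_apply[OF n c] source.id_right[OF u]
    by blast
qed

text \<open>Initiality gives comparison arrows in both directions, and their composites are
  endomorphisms of initial factorizations.\<close>

lemma initial_unique_iso:
  assumes init: "initial_factorization C D F b a f c n u"
    and init': "initial_factorization C D F b a f c' n' u'"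
  shows "\<exists>!w. w \<in> isos C c c' \<and> amap F w \<cdot>\<^bsub>D\<^esub> n = n' \<and> u' \<cdot>\<^bsub>C\<^esub> w = u"
proof -
  have n: "n \<in> hom D b (omap F c)" and u: "u \<in> hom C c a" and f: "amap F u \<cdot>\<^bsub>D\<^esub> n = f"
    using init by (auto simp: initial_factorization_def)
  have n': "n' \<in> hom D b (omap F c')" and u': "u' \<in> hom C c' a" and f': "amap F u' \<cdot>\<^bsub>D\<^esub> n' = f"
    using init' by (auto simp: initial_factorization_def)
  obtain w where w: "w \<in> hom C c c'" "amap F w \<cdot>\<^bsub>D\<^esub> n = n'" "u' \<cdot>\<^bsub>C\<^esub> w = u"
    using initial_ex1[OF init n' u' f'] by blast
  obtain z where z: "z \<in> hom C c' c" "amap F z \<cdot>\<^bsub>D\<^esub> n' = n" "u \<cdot>\<^bsub>C\<^esub> z = u'"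
    using initial_ex1[OF init' n u f] by blast
  have "z \<cdot>\<^bsub>C\<^esub> w = Id C c"
    by (rule initial_endo_eq_Id[OF init source.comp_hom[OF w(1) z(1)]])
      (simp_all add: amap_Comp_apply[OF n w(1) z(1)] source.assoc[OF w(1) z(1) u, symmetric] w z)
  moreover have "w \<cdot>\<^bsub>C\<^esub> z = Id C c'"
    by (rule initial_endo_eq_Id[OF init' source.comp_hom[OF z(1) w(1)]])
      (simp_all add: amap_Comp_apply[OF n' z(1) w(1)] source.assoc[OF z(1) w(1) u', symmetric] w z)
  ultimately have "w \<in> isos C c c'" using w(1) z(1) by (auto simp: isos_def)
  \<comment> \<open>Uniqueness among isomorphisms is inherited from uniqueness among all arrows from
    \<open>c\<close> to \<open>c'\<close>.\<close>
  then show ?thesis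
    using initial_ex1[OF init n' u' f'] w by (auto simp: isos_def)
qed

text \<open>The assumption \<open>all\<close> is applied over the codomain \<open>a2\<close> of an
  arbitrary \<open>u1\<close>, where \<open>init\<close> says nothing directly. The comparison
  \<open>w : c' \<rightarrow> c\<close> acquires a right inverse \<open>z\<close>, which carries
  lifts out of \<open>c'\<close> over to lifts out of \<open>c\<close>.\<close>

lemma initial_imp_candidate:
  assumes all: "\<And>a b f. f \<in> hom D b (omap F a) \<Longrightarrow> a \<in> Obj C
      \<Longrightarrow> \<exists>c n u. initial_factorization C D F b a f c n u"
    and init: "initial_factorization C D F b a f c n u"
  shows "candidate_factorization C D F b a f c n u"
proof -
  have n: "n \<in> hom D b (omap F c)" and u: "u \<in> hom C c a" and f: "amap F u \<cdot>\<^bsub>D\<^esub> n = f"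
    using init by (auto simp: initial_factorization_def)
  note c = source.hom_Obj(1)[OF u]
  have "\<exists>!s. s \<in> hom C c a1 \<and> amap F s \<cdot>\<^bsub>D\<^esub> n = g \<and> v \<cdot>\<^bsub>C\<^esub> s = u1"
    if g: "g \<in> hom D b (omap F a1)" and u1: "u1 \<in> hom C c a2" and v: "v \<in> hom C a1 a2"
      and eq: "amap F v \<cdot>\<^bsub>D\<^esub> g = amap F u1 \<cdot>\<^bsub>D\<^esub> n" for a1 a2 g u1 v
  proof -
    obtain c' n' u'
      where init': "initial_factorization C D F b a2 (amap F u1 \<cdot>\<^bsub>D\<^esub> n) c' n' u'"
      using all[OF target.comp_hom[OF n amap_hom[OF u1]] source.hom_Obj(2)[OF u1]] by blast
    then have n': "n' \<in> hom D b (omap F c')" and u': "u' \<in> hom C c' a2"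
      by (auto simp: initial_factorization_def)
    \<comment> \<open>The pair \<open>(n, u1)\<close> itself factors \<open>U u1\<close> after
      \<open>n\<close>, with \<open>F\<close> here in the role of \<open>U\<close>.\<close>
    obtain w where w: "w \<in> hom C c' c" "amap F w \<cdot>\<^bsub>D\<^esub> n' = n" "u1 \<cdot>\<^bsub>C\<^esub> w = u'"
      using initial_ex1[OF init' n u1 refl] by blast
    \<comment> \<open>Return from \<open>a2\<close> to \<open>a\<close>: composing \<open>w\<close>
      with the original \<open>u\<close> makes \<open>n'\<close> part of a factorization of
      \<open>f\<close>, so \<open>init\<close> supplies \<open>z\<close>.\<close>
    have "amap F (u \<cdot>\<^bsub>C\<^esub> w) \<cdot>\<^bsub>D\<^esub> n' = f"
      by (simp add: amap_Comp_apply[OF n' w(1) u] w f)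
    then obtain z where z: "z \<in> hom C c c'" "amap F z \<cdot>\<^bsub>D\<^esub> n = n'" "u \<cdot>\<^bsub>C\<^esub> w \<cdot>\<^bsub>C\<^esub> z = u"
      using initial_ex1[OF init n' source.comp_hom[OF w(1) u]] by blast
    have wz: "w \<cdot>\<^bsub>C\<^esub> z = Id C c"
      by (rule initial_endo_eq_Id[OF init source.comp_hom[OF z(1) w(1)]])
        (simp_all add: amap_Comp_apply[OF n z(1) w(1)] source.assoc[OF z(1) w(1) u, symmetric] w z)
    \<comment> \<open>By \<open>eq\<close>, the pair \<open>(g, v)\<close> is a competing
      factorization over \<open>a2\<close>. The required lift is then \<open>t\<close> after
      \<open>z\<close>.\<close>
    obtain t where t: "t \<in> hom C c' a1" "amap F t \<cdot>\<^bsub>D\<^esub> n' = g" "v \<cdot>\<^bsub>C\<^esub> t = u'"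
      using initial_ex1[OF init' g v eq] by blast
    show ?thesis
    proof (intro ex1I[of _ "t \<cdot>\<^bsub>C\<^esub> z"] conjI)
      show "t \<cdot>\<^bsub>C\<^esub> z \<in> hom C c a1" using source.comp_hom[OF z(1) t(1)] .
      show "amap F (t \<cdot>\<^bsub>C\<^esub> z) \<cdot>\<^bsub>D\<^esub> n = g" by (simp add: amap_Comp_apply[OF n z(1) t(1)] z t)
      have "v \<cdot>\<^bsub>C\<^esub> (t \<cdot>\<^bsub>C\<^esub> z) = u1 \<cdot>\<^bsub>C\<^esub> w \<cdot>\<^bsub>C\<^esub> z"
        by (simp add: source.assoc[OF z(1) t(1) v, symmetric] t w)
      then show "v \<cdot>\<^bsub>C\<^esub> (t \<cdot>\<^bsub>C\<^esub> z) = u1"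
        by (simp add: source.assoc[OF z(1) w(1) u1] wz source.id_right[OF u1])
    next
      fix s
      assume s: "s \<in> hom C c a1 \<and> amap F s \<cdot>\<^bsub>D\<^esub> n = g \<and> v \<cdot>\<^bsub>C\<^esub> s = u1"
      then have s1: "s \<in> hom C c a1" by blast
      \<comment> \<open>Any lift \<open>s\<close> becomes \<open>t\<close> after precomposition with
        \<open>w\<close>; precomposing further with \<open>z\<close> and using \<open>wz\<close>
        recovers \<open>s\<close>.\<close>
      have "s \<cdot>\<^bsub>C\<^esub> w \<in> hom C c' a1" using source.comp_hom[OF w(1) s1] .
      moreover have "amap F (s \<cdot>\<^bsub>C\<^esub> w) \<cdot>\<^bsub>D\<^esub> n' = g"
        using s by (simp add: amap_Comp_apply[OF n' w(1) s1] w)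
      moreover have "v \<cdot>\<^bsub>C\<^esub> (s \<cdot>\<^bsub>C\<^esub> w) = u'"
        using s by (simp add: source.assoc[OF w(1) s1 v, symmetric] w)
      ultimately have "s \<cdot>\<^bsub>C\<^esub> w = t" using initial_ex1[OF init' g v eq] t by blast
      then show "s = t \<cdot>\<^bsub>C\<^esub> z"
        using source.assoc[OF z(1) w(1) s1] by (simp add: wz source.id_right[OF s1])
    qed
  qed
  then show ?thesis
    using target.hom_Obj(1)[OF n] c n u f
    unfolding candidate_factorization_def candidate_def by blast
qed

end

theorem theorem1p27:
  fixes A :: "('oa, 'ma) cat" and B :: "('ob, 'mb) cat"
    and U :: "('oa, 'ma, 'ob, 'mb) ftor"
  assumes "cat_functor A B U"
  shows "stable A B U \<longleftrightarrow> local_right_adjoint A B U"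
proof -
  interpret cat_functor A B U by fact
  note lra = local_right_adjoint_iff_initial_factorizations[OF assms]
  show ?thesis
  proof
    assume "stable A B U"
    then show "local_right_adjoint A B U"
      unfolding lra stable_def using candidate_imp_initial target.hom_Obj(1) by meson
  next
    assume "local_right_adjoint A B U"
    then have ex: "\<exists>c n u. initial_factorization A B U b a f c n u"
      if "f \<in> hom B b (omap U a)" "a \<in> Obj A" for a b f
      using that unfolding lra by blast
    show "stable A B U"
      unfolding stable_def
    proof (intro ballI conjI allI impI)
      fix b a f
      assume "a \<in> Obj A" "f \<in> hom B b (omap U a)"
      \<comment> \<open>\<open>ex\<close> has two uses: it provides the factorization of
        \<open>f\<close>, and over all other objects it is the assumption that upgrades initiality
        to candidacy.\<close>
      then show "\<exists>c n u. candidate_factorization A B U b a f c n u"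
        using ex initial_imp_candidate[OF ex] by blast
    next
      fix b a f c n u c' n' u'
      assume "candidate_factorization A B U b a f c n u" "candidate_factorization A B U b a f c' n' u'"
      then show "\<exists>!w. w \<in> isos A c c' \<and> amap U w \<cdot>\<^bsub>B\<^esub> n = n' \<and> u' \<cdot>\<^bsub>A\<^esub> w = u"
        using initial_unique_iso candidate_imp_initial by blast
    qed
  qed
qed

end
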